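(* Let $m\ge 2$ be an integer. A Skolem circle of order $m$ exists if and only if $m\equiv 0$ or $1 \pmod 4$.
   Context: Let $C_{2m}$ be the cycle graph with vertices $v_1,\dots,v_{2m}$ in cyclic order ($v_i$ adjacent to $v_{i+1}$, indices mod $2m$). A Skolem circle of order $m$ is a labelling of the vertices of $C_{2m}$ by labels from $\{1,2,\dots,m\}$ such that (1) each label is used exactly twice, and (2) whenever two vertices carry the same label $s$, their distance in $C_{2m}$ is exactly $s$. *)

theory Defs
  imports "Graph_Theory.Graph_Theory" "HOL-Number_Theory.Cong"
begin

text \<open>
  An undirected graph is a symmetric digraph, as in \<^locale>\<open>pair_graph\<close>. The vertex
  \<open>v\<^sub>i\<close> of the cycle is the number \<open>i\<close>, for \<open>1 \<le> i \<le> n\<close>; the successor of \<open>n\<close> is \<open>1\<close>.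
\<close>

definition cycle_graph :: "nat \<Rightarrow> nat pair_pre_digraph" where
  "cycle_graph n =
     \<lparr> pverts = {1..n},
       parcs = {(i, j). i \<in> {1..n} \<and> j \<in> {1..n} \<and>
                        ([j = i + 1] (mod n) \<or> [i = j + 1] (mod n))} \<rparr>"

text \<open>For \<open>n = 1\<close> there would be a loop.\<close>

lemma pair_graph_cycle_graph:
  assumes "n \<ge> 2"
  shows "pair_graph (cycle_graph n)"
proof
  show "finite (parcs (cycle_graph n))"
    by (rule finite_subset[of _ "{1..n} \<times> {1..n}"]) (auto simp: cycle_graph_def)
next
  fix e assume "e \<in> parcs (cycle_graph n)"
  moreover have "\<not> [i = i + 1] (mod n)" for i
  proof
    assume "[i = i + 1] (mod n)"
    then have "[i + 0 = i + 1] (mod n)" by simp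
    then have "[0 = 1] (mod n)" by (simp only: cong_add_lcancel_nat)
    then show False using assms by (simp add: cong_def)
  qed
  ultimately show "fst e \<noteq> snd e" by (auto simp: cycle_graph_def)
qed (auto simp: cycle_graph_def symmetric_def sym_def)

text \<open>
  The distance is the least length of a walk, i.e. the least cost of a walk when every arc has
  cost \<open>1\<close>; the library function takes values in the extended reals.
\<close>

definition graph_dist :: "'a pair_pre_digraph \<Rightarrow> 'a \<Rightarrow> 'a \<Rightarrow> ereal" where
  "graph_dist G u v = wf_digraph.\<mu> (with_proj G) (\<lambda>_. 1) u v"

text \<open>The values of \<open>f\<close> outside \<open>{1..2*m}\<close> are irrelevant.\<close>

definition skolem_circle :: "nat \<Rightarrow> (nat \<Rightarrow> nat) \<Rightarrow> bool" where
  "skolem_circle m f \<longleftrightarrow>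
     (\<forall>v \<in> pverts (cycle_graph (2 * m)). f v \<in> {1..m}) \<and>
     (\<forall>s \<in> {1..m}. card {v \<in> pverts (cycle_graph (2 * m)). f v = s} = 2) \<and>
     (\<forall>s. \<forall>u \<in> pverts (cycle_graph (2 * m)). \<forall>v \<in> pverts (cycle_graph (2 * m)).
        u \<noteq> v \<and> f u = s \<and> f v = s \<longrightarrow> graph_dist (cycle_graph (2 * m)) u v = ereal (real s))"

end

theory Submission
  imports Defs
begin

text \<open>
  Every walk between two vertices of an even cycle has the parity of the difference of their
  numbers, so the two vertices labelled \<open>s\<close> have numbers with sum congruent to \<open>s\<close> modulo \<open>2\<close>.
  Summing over all labels gives \<open>m (2 m + 1) \<equiv> m (m + 1) / 2\<close> modulo \<open>2\<close>, i.e.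
  \<open>m \<equiv> 0\<close> or \<open>1\<close> modulo \<open>4\<close>. Conversely, for these \<open>m\<close> there is a Skolem sequence: \<open>{1..2m}\<close> is
  a disjoint union of pairs \<open>{a d, a d + d}\<close> with \<open>1 \<le> d \<le> m\<close>. On the cycle the two members of
  such a pair have distance \<open>d\<close>, because \<open>d \<le> m\<close>.
\<close>

section \<open>Distances in a cycle\<close>

lemma (in pair_wf_digraph) awalk_cost_const_1: "awalk_cost (\<lambda>_. 1) p = real (length p)"
  by (induct p) auto

lemma (in pair_wf_digraph) graph_dist_leI:
  assumes "awalk u p v"
  shows "graph_dist G u v \<le> ereal (real (length p))"
  using min_cost_le_walk_cost[OF assms, of "\<lambda>_. 1"]
  by (simp add: graph_dist_def awalk_cost_const_1)

lemma (in pair_wf_digraph) graph_dist_geI: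
  assumes "\<And>p. awalk u p v \<Longrightarrow> s \<le> length p"
  shows "ereal (real s) \<le> graph_dist G u v"
  unfolding graph_dist_def \<mu>_def
  by (rule INF_greatest) (simp add: awalk_cost_const_1 assms)

text \<open>Lengths are natural numbers, so if every walk were longer than \<open>s\<close>, the
  infimum would be at least \<open>Suc s\<close>. This yields an actual walk, whose parity can then
  be studied.\<close>

lemma (in pair_wf_digraph) graph_dist_attained:
  assumes "graph_dist G u v = ereal (real s)"
  obtains p where "awalk u p v" "length p = s"
proof -
  have "\<exists>p. awalk u p v \<and> length p \<le> s"
  proof (rule ccontr)
    assume "\<nexists>p. awalk u p v \<and> length p \<le> s"
    then have "ereal (real (Suc s)) \<le> graph_dist G u v"
      by (intro graph_dist_geI) (auto simp: not_le Suc_le_eq)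
    then show False using assms by simp
  qed
  then obtain p where p: "awalk u p v" "length p \<le> s" by blast
  moreover have "s \<le> length p"
    using graph_dist_leI[OF p(1)] assms by simp
  ultimately show thesis using that by simp
qed

text \<open>Every arc moves by 1 or -1 modulo \<open>n\<close>, and \<open>k\<close> is the sum of
  these moves. Its bound gives lower bounds on distances; its parity gives necessity.\<close>

lemma cycle_graph_awalk_displacement:
  assumes "pre_digraph.awalk (with_proj (cycle_graph n)) u p v" "n \<ge> 2"
  shows "\<exists>k::int. \<bar>k\<bar> \<le> int (length p) \<and> even (k - int (length p)) \<and>
           [int v = int u + k] (mod (int n))"
proof -
  interpret pair_graph "cycle_graph n" using assms(2) by (rule pair_graph_cycle_graph)
  show ?thesis using assms(1)
  proof (induct p arbitrary: u)
    case Nil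
    then show ?case by (intro exI[of _ 0]) (auto simp: awalk_Nil_iff)
  next
    case (Cons e p)
    obtain w where e: "e = (u, w)" "(u, w) \<in> parcs (cycle_graph n)" and w: "awalk w p v"
      using Cons.prems by (cases e) (auto simp: awalk_Cons_iff)
    from Cons.hyps[OF w] obtain k :: int where
      k: "\<bar>k\<bar> \<le> int (length p)" "even (k - int (length p))" "[int v = int w + k] (mod (int n))"
      by blast
    have "[w = u + 1] (mod n) \<or> [u = w + 1] (mod n)"
      using e(2) by (auto simp: cycle_graph_def)
    \<comment> \<open>Over the integers a backward arc is a move by -1.\<close>
    then have "[int w = int u + 1] (mod (int n)) \<or> [int u = int w + 1] (mod (int n))"
      by (metis cong_int_iff of_nat_1 of_nat_add)
    then consider "[int w = int u + 1] (mod (int n))" | "[int w = int u - 1] (mod (int n))"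
      by (auto simp: cong_iff_dvd_diff algebra_simps dvd_diff_commute)
    then show ?case
    proof cases
      case 1
      have "[int v = int u + (k + 1)] (mod (int n))"
        using cong_trans[OF k(3) cong_add[OF 1 cong_refl]] by (simp add: algebra_simps)
      then show ?thesis using k(1,2) by (intro exI[of _ "k + 1"]) auto
    next
      case 2
      have "[int v = int u + (k - 1)] (mod (int n))"
        using cong_trans[OF k(3) cong_add[OF 2 cong_refl]] by (simp add: algebra_simps)
      then show ?thesis using k(1,2) by (intro exI[of _ "k - 1"]) auto
    qed
  qed
qed

lemma cycle_graph_awalk_up:
  assumes "1 \<le> u" "u + s \<le> n" "n \<ge> 2"
  shows "\<exists>p. pre_digraph.awalk (with_proj (cycle_graph n)) u p (u + s) \<and> length p = s"
proof -
  interpret pair_graph "cycle_graph n" using assms(3) by (rule pair_graph_cycle_graph)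
  show ?thesis using assms(1,2)
  proof (induct s arbitrary: u)
    case 0
    then have "u \<in> pverts (cycle_graph n)" by (simp add: cycle_graph_def)
    then show ?case by (intro exI[of _ "[]"]) (simp add: awalk_Nil_iff)
  next
    case (Suc s)
    from Suc.hyps[of "Suc u"] Suc.prems obtain p where
      "awalk (Suc u) p (u + Suc s)" "length p = s" by auto
    moreover have "(u, Suc u) \<in> parcs (cycle_graph n)"
      using Suc.prems by (auto simp: cycle_graph_def)
    ultimately show ?case by (intro exI[of _ "(u, Suc u) # p"]) (auto simp: awalk_Cons_iff)
  qed
qed

lemma cycle_graph_awalk_down:
  assumes "1 \<le> u" "u + s \<le> n" "n \<ge> 2"
  shows "\<exists>p. pre_digraph.awalk (with_proj (cycle_graph n)) (u + s) p u \<and> length p = s"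
proof -
  interpret pair_graph "cycle_graph n" using assms(3) by (rule pair_graph_cycle_graph)
  show ?thesis using assms(1,2)
  proof (induct s)
    case 0
    then have "u \<in> pverts (cycle_graph n)" by (simp add: cycle_graph_def)
    then show ?case by (intro exI[of _ "[]"]) (simp add: awalk_Nil_iff)
  next
    case (Suc s)
    from Suc obtain p where "awalk (u + s) p u" "length p = s" by auto
    moreover have "(u + Suc s, u + s) \<in> parcs (cycle_graph n)"
      using Suc.prems by (auto simp: cycle_graph_def)
    ultimately show ?case
      by (intro exI[of _ "(u + Suc s, u + s) # p"]) (auto simp: awalk_Cons_iff)
  qed
qed

text \<open>If \<open>k\<close> were smaller than \<open>x\<close> in absolute value, then
  \<open>k - x\<close> would be a nonzero multiple of \<open>n\<close> of absolute value below
  \<open>2 * \<bar>x\<bar>\<close>, hence below \<open>n\<close>.\<close>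

lemma int_cong_short_displacement:
  fixes k x :: int
  assumes "[k = x] (mod (int n))" "2 * \<bar>x\<bar> \<le> int n"
  shows "\<bar>x\<bar> \<le> \<bar>k\<bar>"
proof (rule ccontr)
  assume "\<not> \<bar>x\<bar> \<le> \<bar>k\<bar>"
  then have "\<bar>k - x\<bar> < int n" "k - x \<noteq> 0" using assms(2) by auto
  moreover have "int n dvd k - x" using assms(1) by (simp add: cong_iff_dvd_diff)
  ultimately show False using dvd_imp_le_int[of "k - x" "int n"] by simp
qed

text \<open>The direct walk gives the upper bound. For the lower bound, the displacement of any walk
  is congruent to \<open>s\<close> or \<open>- s\<close>, and \<open>2 * s \<le> n\<close> makes
  these shortest in their classes. Both directions are needed because labels are compared on ordered
  pairs of vertices.\<close>

lemma cycle_graph_dist: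
  assumes "1 \<le> u" "u + s \<le> n" "2 * s \<le> n" "n \<ge> 2"
  shows "graph_dist (cycle_graph n) u (u + s) = ereal (real s)" (is ?up)
    and "graph_dist (cycle_graph n) (u + s) u = ereal (real s)" (is ?down)
proof -
  interpret pair_graph "cycle_graph n" using assms(4) by (rule pair_graph_cycle_graph)
  show ?up
  proof (rule antisym)
    show "graph_dist (cycle_graph n) u (u + s) \<le> ereal (real s)"
      using cycle_graph_awalk_up[OF assms(1,2,4)] graph_dist_leI by blast
    show "ereal (real s) \<le> graph_dist (cycle_graph n) u (u + s)"
    proof (rule graph_dist_geI)
      fix p assume "awalk u p (u + s)"
      from cycle_graph_awalk_displacement[OF this assms(4)] obtain k :: int where
        k: "\<bar>k\<bar> \<le> int (length p)" "[int (u + s) = int u + k] (mod (int n))" by blast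
      then have "[k = int s] (mod (int n))"
        by (auto simp: cong_iff_dvd_diff dvd_diff_commute)
      from int_cong_short_displacement[OF this] show "s \<le> length p" using assms(3) k(1) by auto
    qed
  qed
  show ?down
  proof (rule antisym)
    show "graph_dist (cycle_graph n) (u + s) u \<le> ereal (real s)"
      using cycle_graph_awalk_down[OF assms(1,2,4)] graph_dist_leI by blast
    show "ereal (real s) \<le> graph_dist (cycle_graph n) (u + s) u"
    proof (rule graph_dist_geI)
      fix p assume "awalk (u + s) p u"
      from cycle_graph_awalk_displacement[OF this assms(4)] obtain k :: int where
        k: "\<bar>k\<bar> \<le> int (length p)" "[int u = int (u + s) + k] (mod (int n))" by blast
      then have "int n dvd - (k + int s)" by (simp add: cong_iff_dvd_diff algebra_simps)
      then have "int n dvd k + int s" by (simp only: dvd_minus_iff)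
      then have "[k = - int s] (mod (int n))" by (simp add: cong_iff_dvd_diff)
      from int_cong_short_displacement[OF this] show "s \<le> length p" using assms(3) k(1) by auto
    qed
  qed
qed

text \<open>The modulus is even, so a walk of length \<open>s\<close> attaining the distance has a
  displacement with the parity of both \<open>s\<close> and \<open>v - u\<close>.\<close>

lemma cycle_graph_dist_parity:
  assumes "graph_dist (cycle_graph (2 * m)) u v = ereal (real s)" "m \<ge> 1"
  shows "even (u + v + s)"
proof -
  have m: "2 * m \<ge> 2" using assms(2) by simp
  interpret pair_graph "cycle_graph (2 * m)" using m by (rule pair_graph_cycle_graph)
  obtain p where p: "awalk u p v" "length p = s"
    using assms(1) by (rule graph_dist_attained)
  from cycle_graph_awalk_displacement[OF p(1) m] p(2) obtain k :: int where
    k: "even (k - int s)" "[int v = int u + k] (mod (int (2 * m)))" by blast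
  have "even (int (2 * m))" by simp
  moreover have "int (2 * m) dvd int v - (int u + k)"
    using k(2) by (simp only: cong_iff_dvd_diff)
  ultimately have "even (int v - (int u + k))" by (rule dvd_trans)
  with k(1) show ?thesis by auto
qed

section \<open>Necessity\<close>

lemma skolem_circle_imp_cong:
  assumes f: "skolem_circle m f" and m: "m \<ge> 1"
  shows "[m = 0] (mod 4) \<or> [m = 1] (mod 4)"
proof -
  define V where "V s = {v \<in> {1..2*m}. f v = s}" for s
  have range: "f v \<in> {1..m}" if "v \<in> {1..2*m}" for v
    using f that by (auto simp: skolem_circle_def cycle_graph_def)
  have parity: "even (\<Sum>(V s) + s)" if s: "s \<in> {1..m}" for s
  proof -
    have "card (V s) = 2"
      using f s by (auto simp: skolem_circle_def cycle_graph_def V_def)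
    then obtain u v where uv: "V s = {u, v}" "u \<noteq> v" by (auto simp: card_2_iff)
    then have "u \<in> V s" "v \<in> V s" by auto
    then have "graph_dist (cycle_graph (2 * m)) u v = ereal (real s)"
      using f uv(2) by (auto simp: skolem_circle_def cycle_graph_def V_def)
    from cycle_graph_dist_parity[OF this m] uv show ?thesis by simp
  qed
  \<comment> \<open>The label classes partition the vertices.\<close>
  have "(\<Sum>s\<in>{1..m}. \<Sum>(V s)) = \<Sum>{1..2*m}"
    unfolding V_def by (rule sum.group) (use range in auto)
  moreover have "even (\<Sum>s\<in>{1..m}. \<Sum>(V s) + s)"
    by (rule dvd_sum) (rule parity)
  ultimately have "even (\<Sum>{1..2*m} + \<Sum>{1..m})" by (simp add: sum.distrib)
  \<comment> \<open>Doubling clears the denominators of the Gauss sums: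
    \<open>2 * m * (2 * m + 1) + m * (m + 1)\<close>. The residues 2 and 3 modulo 4 are then
    excluded by inspection.\<close>
  moreover have "2 * (\<Sum>{1..2*m} + \<Sum>{1..m}) = m * (5 * m + 3)"
    using double_gauss_sum_from_Suc_0[of "2*m", where ?'a = nat]
      double_gauss_sum_from_Suc_0[of m, where ?'a = nat]
    by (simp add: algebra_simps)
  ultimately have "4 dvd m * (5 * m + 3)" by presburger
  then have "(m * (5 * m + 3)) mod 4 = 0" by simp
  then have "((m mod 4) * (5 * (m mod 4) + 3)) mod 4 = 0"
    by (metis mod_add_left_eq mod_mult_eq mod_mult_right_eq)
  moreover have "m mod 4 \<in> {0, 1, 2, 3}" by auto
  ultimately show ?thesis by (auto simp: cong_def)
qed

section \<open>Sufficiency\<close>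

text \<open>Since \<open>2 m\<close> positions are covered by \<open>m\<close> pairs, the pairs are automatically disjoint.\<close>

lemma ex_skolem_circle_if_pairs_cover:
  fixes a :: "nat \<Rightarrow> nat"
  assumes cover: "\<And>p. p \<in> {1..2*m} \<Longrightarrow> \<exists>d\<in>{1..m}. p = a d \<or> p = a d + d"
    and m: "m \<ge> 1"
  shows "\<exists>f. skolem_circle m f"
proof -
  \<comment> \<open>The flag selects an end of the pair with difference \<open>d\<close>:
    \<open>False\<close> the left one, \<open>True\<close> the right one.\<close>
  define D where "D = {1..m} \<times> (UNIV :: bool set)"
  define h where "h = (\<lambda>(d, b). a d + (if b then d else 0))"
  have fin: "finite D" and card_D: "card D = 2 * m"
    by (auto simp: D_def)
  have sub: "{1..2*m} \<subseteq> h ` D"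
  proof
    fix p assume "p \<in> {1..2*m}"
    from cover[OF this] obtain d b where "d \<in> {1..m}" "p = h (d, b)"
      by (fastforce simp: h_def)
    then show "p \<in> h ` D" by (auto simp: D_def)
  qed
  \<comment> \<open>Pigeonhole: the image contains \<open>2 * m\<close> positions and cannot have
    more elements, so it equals \<open>{1..2*m}\<close> and \<open>h\<close> is injective. Each
    position thus has a unique label.\<close>
  have card_img: "card (h ` D) \<le> 2 * m" using card_image_le[OF fin, of h] card_D by simp
  have img: "{1..2*m} = h ` D"
    using card_seteq[OF _ sub] fin card_img by simp
  then have inj: "inj_on h D"
    by (metis card_D card_atLeastAtMost diff_Suc_1 eq_card_imp_inj_on fin)
  define f where "f p = fst (inv_into D h p)" for p
  have f_h: "f (h x) = fst x" if "x \<in> D" for x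
    using inv_into_f_f[OF inj that] by (simp add: f_def)
  have fibre: "{v \<in> {1..2*m}. f v = s} = {a s, a s + s}" if "s \<in> {1..m}" for s
  proof -
    have "{v \<in> {1..2*m}. f v = s} = h ` {x \<in> D. fst x = s}"
      unfolding img using f_h by auto
    also have "{x \<in> D. fst x = s} = {(s, False), (s, True)}"
      using that by (auto simp: D_def)
    finally show ?thesis by (simp add: h_def)
  qed
  have dist: "graph_dist (cycle_graph (2 * m)) u v = ereal (real (f u))"
    if uv: "u \<in> {1..2*m}" "v \<in> {1..2*m}" "u \<noteq> v" "f v = f u" for u v
  proof -
    define s where "s = f u"
    have s: "s \<in> {1..m}" using uv(1) f_h unfolding img s_def by (auto simp: D_def)
    have "u \<in> {a s, a s + s}" "v \<in> {a s, a s + s}"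
      using uv s_def fibre[OF s] by auto
    moreover have "1 \<le> a s" "a s + s \<le> 2 * m" using fibre[OF s] by auto
    ultimately show ?thesis
      using cycle_graph_dist[of "a s" s "2 * m"] s uv(3) m unfolding s_def[symmetric] by auto
  qed
  have "skolem_circle m f"
    unfolding skolem_circle_def
  proof (intro conjI ballI allI impI)
    fix v assume "v \<in> pverts (cycle_graph (2 * m))"
    then have "v \<in> h ` D" by (simp add: cycle_graph_def flip: img)
    then show "f v \<in> {1..m}" using f_h by (auto simp: D_def)
  next
    fix s assume "s \<in> {1..m}"
    with fibre[OF this] show "card {v \<in> pverts (cycle_graph (2 * m)). f v = s} = 2"
      by (simp add: cycle_graph_def)
  next
    fix s u v
    assume "u \<in> pverts (cycle_graph (2 * m))" "v \<in> pverts (cycle_graph (2 * m))"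
      "u \<noteq> v \<and> f u = s \<and> f v = s"
    then show "graph_dist (cycle_graph (2 * m)) u v = ereal (real s)"
      using dist[of u v] by (auto simp: cycle_graph_def)
  qed
  then show ?thesis by blast
qed

text \<open>The even labels are placed symmetrically around the position \<open>c\<close>.\<close>

lemma ex_skolem_circle_if_odd_pairs_cover:
  fixes b :: "nat \<Rightarrow> nat"
  assumes c: "m div 2 < c" "c + m div 2 \<le> 2 * m"
    and cover: "\<And>p. p \<in> {1..2*m} \<Longrightarrow> p < c - m div 2 \<or> p = c \<or> p > c + m div 2 \<Longrightarrow>
      \<exists>k. 2 * k + 1 \<le> m \<and> (p = b k \<or> p = b k + (2 * k + 1))"
    and m: "m \<ge> 1"
  shows "\<exists>f. skolem_circle m f"
proof (rule ex_skolem_circle_if_pairs_cover[OF _ m])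
  \<comment> \<open>An even label \<open>2 * e\<close> sits at \<open>c - e\<close> and
    \<open>c + e\<close>, so the even labels fill the block of radius \<open>m div 2\<close> around
    \<open>c\<close>, except \<open>c\<close> itself. All other positions are left to the odd labels
    \<open>2 * k + 1\<close>.\<close>
  let ?a = "\<lambda>d. if even d then c - d div 2 else b (d div 2)"
  fix p assume p: "p \<in> {1..2*m}"
  consider "p < c - m div 2 \<or> p = c \<or> p > c + m div 2"
    | "c - m div 2 \<le> p" "p < c" | "c < p" "p \<le> c + m div 2"
    by linarith
  then show "\<exists>d\<in>{1..m}. p = ?a d \<or> p = ?a d + d"
  proof cases
    case 1
    from cover[OF p 1] obtain k where "2 * k + 1 \<le> m" "p = b k \<or> p = b k + (2 * k + 1)"
      by blast
    then show ?thesis by (intro bexI[of _ "2 * k + 1"]) auto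
  next
    case 2
    then show ?thesis by (intro bexI[of _ "2 * (c - p)"]) auto
  next
    case 3
    then have "2 * (p - c) \<in> {1..m}" "p = c - (p - c) + 2 * (p - c)" using c by auto
    then show ?thesis by (intro bexI[of _ "2 * (p - c)"]) auto
  qed
qed

section \<open>Explicit placements for both residue classes\<close>

text \<open>The labels in order are 1 1 4 2 3 2 4 3. Orders 4 and 5 are separate because for
  \<open>s = 1\<close> the special indices \<open>0\<close> and \<open>s - 1\<close> of the general
  placements collide.\<close>

lemma ex_skolem_circle_4: "\<exists>f. skolem_circle 4 f"
proof (rule ex_skolem_circle_if_pairs_cover)
  let ?a = "\<lambda>d::nat. if d = 1 then 1 else if d = 2 then 4 else if d = 3 then 5 else 3::nat"
  fix p :: nat assume "p \<in> {1..2*4}"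
  then have "p \<in> {1, 2, 3, 4, 5, 6, 7, 8}" by auto
  moreover have "{1..4} = {1, 2, 3, 4::nat}" by auto
  ultimately show "\<exists>d\<in>{1..4}. p = ?a d \<or> p = ?a d + d" by auto
qed simp

text \<open>The labels in order are 2 4 2 3 5 4 3 1 1 5.\<close>

lemma ex_skolem_circle_5: "\<exists>f. skolem_circle 5 f"
proof (rule ex_skolem_circle_if_pairs_cover)
  let ?a = "\<lambda>d::nat. if d = 1 then 8 else if d = 2 then 1 else if d = 3 then 4
    else if d = 4 then 2 else 5::nat"
  fix p :: nat assume "p \<in> {1..2*5}"
  then have "p \<in> {1, 2, 3, 4, 5, 6, 7, 8, 9, 10}" by simp presburger
  moreover have "{1..5} = {1, 2, 3, 4, 5::nat}" by auto
  ultimately show "\<exists>d\<in>{1..5}. p = ?a d \<or> p = ?a d + d" by auto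
qed simp

lemma ex_skolem_circle_mult_4:
  assumes s: "s \<ge> 2"
  shows "\<exists>f. skolem_circle (4 * s) f"
proof -
  \<comment> \<open>Even labels leave \<open>1\<close> to \<open>4 * s - 1\<close> and the centre
    \<open>6 * s\<close>. Most odd labels form two nests of concentric pairs, with end sums
    \<open>4 * s - 1\<close> for \<open>k > s\<close> and \<open>4 * s + 1\<close> for
    \<open>k < s - 1\<close>. The labels 1, \<open>2 * s - 1\<close>, \<open>2 * s + 1\<close> and
    \<open>4 * s - 1\<close> fill the gaps, the last one reaching the centre.\<close>
  define b where "b k = (if k = 0 then s else if k = 2 * s - 1 then 2 * s + 1
    else if k = s then s - 1 else if k = s - 1 then 2 * s
    else if k > s then 2 * s - 1 - k else 2 * s - k)" for k
  have b: "b 0 = s" "b (2 * s - 1) = 2 * s + 1" "b s = s - 1" "b (s - 1) = 2 * s"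
    using s by (auto simp: b_def)
  have b_high: "b k = 2 * s - 1 - k" if "s < k" "k < 2 * s - 1" for k
    using that by (auto simp: b_def)
  have b_low: "b k = 2 * s - k" if "0 < k" "k < s - 1" for k
    using that by (auto simp: b_def)
  show ?thesis
  proof (rule ex_skolem_circle_if_odd_pairs_cover[where c = "6 * s" and b = b])
    fix p assume p: "p \<in> {1..2 * (4 * s)}"
      "p < 6 * s - 4 * s div 2 \<or> p = 6 * s \<or> p > 6 * s + 4 * s div 2"
    let ?goal = "\<lambda>k. 2 * k + 1 \<le> 4 * s \<and> (p = b k \<or> p = b k + (2 * k + 1))"
    have "1 \<le> p" "p + 1 \<le> 4 * s \<or> p = 6 * s" using p by auto
    \<comment> \<open>From left to right: the intervals are the left or right ends of a nest, the
      single positions belong to the four special labels.\<close>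
    then consider "1 \<le> p" "p + 2 \<le> s" | "p + 1 = s" | "p = s \<or> p = s + 1"
      | "s + 2 \<le> p" "p < 2 * s" | "p = 2 * s" | "p = 2 * s + 1"
      | "2 * s + 2 \<le> p" "p < 3 * s" | "p = 3 * s"
      | "3 * s < p" "p + 2 \<le> 4 * s" | "p + 1 = 4 * s" | "p = 6 * s"
      by linarith
    then show "\<exists>k. ?goal k"
    proof cases
      case 1
      then have "?goal (2 * s - 1 - p)" by (subst (1 2) b_high) auto
      then show ?thesis ..
    next
      case 2
      then have "?goal s" using s b by auto
      then show ?thesis ..
    next
      case 3
      then have "?goal 0" using s b by auto
      then show ?thesis ..
    next
      case 4
      then have "?goal (2 * s - p)" by (subst (1 2) b_low) auto
      then show ?thesis ..
    next
      case 5
      then have "?goal (s - 1)" using s b by auto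
      then show ?thesis ..
    next
      case 6
      then have "?goal (2 * s - 1)" using s b by auto
      then show ?thesis ..
    next
      case 7
      then have "?goal (p - 2 * s - 1)" by (subst (1 2) b_low) auto
      then show ?thesis ..
    next
      case 8
      then have "?goal s" using s b by auto
      then show ?thesis ..
    next
      case 9
      then have "?goal (p - 2 * s)" by (subst (1 2) b_high) auto
      then show ?thesis ..
    next
      case 10
      then have "?goal (s - 1)" using s b by auto
      then show ?thesis ..
    next
      case 11
      then have "?goal (2 * s - 1)" using s b by auto
      then show ?thesis ..
    qed
  qed (use s in auto)
qed

lemma ex_skolem_circle_mult_4_plus_1:
  assumes s: "s \<ge> 2"
  shows "\<exists>f. skolem_circle (4 * s + 1) f"
proof -
  \<comment> \<open>Now \<open>1\<close> to \<open>4 * s + 1\<close> and the centre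
    \<open>6 * s + 2\<close> remain. The nests have end sums \<open>4 * s + 1\<close> for
    \<open>s \<le> k\<close> and \<open>4 * s + 3\<close> for \<open>k < s - 1\<close>; the special
    labels are 1, \<open>2 * s - 1\<close> and \<open>4 * s + 1\<close>, the last one reaching the
    centre.\<close>
  define b where "b k = (if k = 0 then s + 1 else if k = 2 * s then 2 * s + 1
    else if k = s - 1 then 2 * s + 2 else if k \<ge> s then 2 * s - k else 2 * s + 1 - k)" for k
  have b: "b 0 = s + 1" "b (2 * s) = 2 * s + 1" "b (s - 1) = 2 * s + 2"
    using s by (auto simp: b_def)
  have b_high: "b k = 2 * s - k" if "s \<le> k" "k < 2 * s" for k
    using s that by (auto simp: b_def)
  have b_low: "b k = 2 * s + 1 - k" if "0 < k" "k < s - 1" for k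
    using that by (auto simp: b_def)
  show ?thesis
  proof (rule ex_skolem_circle_if_odd_pairs_cover[where c = "6 * s + 2" and b = b])
    fix p assume p: "p \<in> {1..2 * (4 * s + 1)}"
      "p < 6 * s + 2 - (4 * s + 1) div 2 \<or> p = 6 * s + 2 \<or> p > 6 * s + 2 + (4 * s + 1) div 2"
    let ?goal = "\<lambda>k. 2 * k + 1 \<le> 4 * s + 1 \<and> (p = b k \<or> p = b k + (2 * k + 1))"
    have "1 \<le> p" "p \<le> 4 * s + 1 \<or> p = 6 * s + 2" using p by auto
    then consider "1 \<le> p" "p \<le> s" | "p = s + 1 \<or> p = s + 2" | "s + 3 \<le> p" "p \<le> 2 * s"
      | "p = 2 * s + 1 \<or> p = 6 * s + 2" | "p = 2 * s + 2 \<or> p = 4 * s + 1"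
      | "2 * s + 3 \<le> p" "p \<le> 3 * s" | "3 * s < p" "p \<le> 4 * s"
      by linarith
    then show "\<exists>k. ?goal k"
    proof cases
      case 1
      then have "?goal (2 * s - p)" by (subst (1 2) b_high) auto
      then show ?thesis ..
    next
      case 2
      then have "?goal 0" using s b by auto
      then show ?thesis ..
    next
      case 3
      then have "?goal (2 * s + 1 - p)" by (subst (1 2) b_low) auto
      then show ?thesis ..
    next
      case 4
      then have "?goal (2 * s)" using s b by auto
      then show ?thesis ..
    next
      case 5
      then have "?goal (s - 1)" using s b by auto
      then show ?thesis ..
    next
      case 6
      then have "?goal (p - 2 * s - 2)" by (subst (1 2) b_low) auto
      then show ?thesis ..
    next
      case 7
      then have "?goal (p - 2 * s - 1)" by (subst (1 2) b_high) auto
      then show ?thesis ..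
    qed
  qed (use s in auto)
qed

theorem theorem2:
  fixes m :: nat
  assumes "m \<ge> 2"
  shows "(\<exists>f. skolem_circle m f) \<longleftrightarrow> [m = 0] (mod 4) \<or> [m = 1] (mod 4)"
proof
  assume "\<exists>f. skolem_circle m f"
  then obtain f where "skolem_circle m f" ..
  then show "[m = 0] (mod 4) \<or> [m = 1] (mod 4)"
    by (rule skolem_circle_imp_cong) (use assms in simp)
next
  assume "[m = 0] (mod 4) \<or> [m = 1] (mod 4)"
  then have "m = 4 * (m div 4) \<or> m = 4 * (m div 4) + 1"
    by (auto simp: cong_def) presburger
  \<comment> \<open>Quotient 0 would force \<open>m\<close> to be 0 or 1; quotient 1 gives the
    orders 4 and 5.\<close>
  moreover have "m div 4 = 1 \<or> m div 4 \<ge> 2" using calculation assms by linarith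
  ultimately show "\<exists>f. skolem_circle m f"
    using ex_skolem_circle_4 ex_skolem_circle_5
      ex_skolem_circle_mult_4[of "m div 4"] ex_skolem_circle_mult_4_plus_1[of "m div 4"]
    by auto
qed

end
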